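(* Let $M,N\in\mathbb{Z}^{r\times n}$ (where $0<r\le n$) be two full-rank weakly unimodular matrices with irredundant columns, and assume that the polytopes $\mathcal{P}_M$ and $\mathcal{P}_N$ are unimodularly equivalent. Then there exist $F\in\mathrm{GL}_r(\mathbb{Z})$ and a signed permutation matrix $P\in\mathbb{Z}^{n\times n}$ such that $N=FMP$. In particular, $N$ and $M$ represent the same simple regular matroid.
   Context: A matrix $M\in\mathbb{Z}^{r\times n}$ with $0<r\le n$ is full-rank weakly unimodular if it has rank $r$ and every $r\times r$ minor lies in $\{0,\pm1\}$. $M$ has irredundant columns if no column is zero and no two distinct columns $\mathbf{c}_i,\mathbf{c}_j$ satisfy $\mathbf{c}_i=\pm\mathbf{c}_j$ (equivalently, the matroid represented by $M$ on the column index set is simple). $\mathcal{P}_M\subseteq\mathbb{R}^r$ is the convex hull of the columns of $[M\mid -M]$. Two polytopes $P,Q\subseteq\mathbb{R}^r$ are unimodularly equivalent if $Q=F(P)+\mathbf{v}$ for some $F\in\mathrm{GL}_r(\mathbb{Z})$ and $\mathbf{v}\in\mathbb{Z}^r$. A signed permutation matrix is a permutation matrix with some entries $1$ replaced by $-1$. *)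

theory Defs
  imports "Jordan_Normal_Form.Determinant" "HOL-Analysis.Analysis"
begin

no_notation Matrix.vec_index (infixl "$" 100)

(* The injection f selects the columns of a submatrix and orders them; changing the order
   changes the minor only by a sign, and the condition is symmetric in the sign. *)
definition weakly_unimodular :: "int ^ 'n ^ 'r \<Rightarrow> bool" where
  "weakly_unimodular M \<longleftrightarrow>
     (\<forall>f :: 'r \<Rightarrow> 'n. inj f \<longrightarrow> Determinants.det (\<chi> i k. M $ i $ f k) \<in> {-1, 0, 1})"

definition full_rank_weakly_unimodular :: "int ^ 'n ^ 'r \<Rightarrow> bool" where
  "full_rank_weakly_unimodular M \<longleftrightarrow>
     rank (map_matrix real_of_int M) = CARD('r) \<and> weakly_unimodular M"

definition irredundant_columns :: "int ^ 'n ^ 'r \<Rightarrow> bool" where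
  "irredundant_columns M \<longleftrightarrow>
     (\<forall>j. column j M \<noteq> 0) \<and>
     (\<forall>i j. i \<noteq> j \<longrightarrow> column i M \<noteq> column j M \<and> column i M \<noteq> - column j M)"

definition hcat :: "'a ^ 'n ^ 'r \<Rightarrow> 'a ^ 'm ^ 'r \<Rightarrow> 'a ^ ('n + 'm) ^ 'r" where
  "hcat A B = (\<chi> i j. case j of Inl k \<Rightarrow> A $ i $ k | Inr k \<Rightarrow> B $ i $ k)"

definition sym_polytope :: "int ^ 'n ^ 'r \<Rightarrow> (real ^ 'r) set" where
  "sym_polytope M = convex hull (columns (map_matrix real_of_int (hcat M (- M))))"

(* invertible is taken over the ring int, so it describes membership in GL_r(Z). *)
definition unimodularly_equivalent :: "(real ^ 'r) set \<Rightarrow> (real ^ 'r) set \<Rightarrow> bool" where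
  "unimodularly_equivalent P Q \<longleftrightarrow>
     (\<exists>(F :: int ^ 'r ^ 'r) (v :: int ^ 'r). invertible F \<and>
        Q = (\<lambda>x. map_matrix real_of_int F *v x + (\<chi> i. real_of_int (v $ i))) ` P)"

definition permutation_matrix :: "int ^ 'n ^ 'n \<Rightarrow> bool" where
  "permutation_matrix P \<longleftrightarrow>
     (\<exists>\<sigma>. \<sigma> permutes UNIV \<and> P = (\<chi> i j. if i = \<sigma> j then 1 else 0))"

definition signed_permutation_matrix :: "int ^ 'n ^ 'n \<Rightarrow> bool" where
  "signed_permutation_matrix P \<longleftrightarrow>
     (\<exists>Q. permutation_matrix Q \<and>
        (\<forall>i j. P $ i $ j = Q $ i $ j \<or> Q $ i $ j = 1 \<and> P $ i $ j = - 1))"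

(* A pair of a ground set and a family of independent sets. *)
type_synonym 'a set_system = "'a set \<times> 'a set set"

definition matroid :: "'a set_system \<Rightarrow> bool" where
  "matroid = (\<lambda>(E, \<I>). finite E \<and> \<I> \<subseteq> Pow E \<and> {} \<in> \<I> \<and>
     (\<forall>X\<in>\<I>. \<forall>Y\<subseteq>X. Y \<in> \<I>) \<and>
     (\<forall>X\<in>\<I>. \<forall>Y\<in>\<I>. card X < card Y \<longrightarrow> (\<exists>y\<in>Y - X. insert y X \<in> \<I>)))"

definition circuit :: "'a set_system \<Rightarrow> 'a set \<Rightarrow> bool" where
  "circuit = (\<lambda>(E, \<I>) C. C \<subseteq> E \<and> C \<notin> \<I> \<and> (\<forall>X. X \<subset> C \<longrightarrow> X \<in> \<I>))"

definition simple_matroid :: "'a set_system \<Rightarrow> bool" where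
  "simple_matroid T \<longleftrightarrow> matroid T \<and> (\<forall>C. circuit T C \<longrightarrow> card C \<noteq> 1 \<and> card C \<noteq> 2)"

definition matroid_isomorphic :: "'a set_system \<Rightarrow> 'b set_system \<Rightarrow> bool" where
  "matroid_isomorphic = (\<lambda>(E, \<I>) (E', \<I>').
     \<exists>\<phi>. bij_betw \<phi> E E' \<and> (\<forall>X\<subseteq>E. X \<in> \<I> \<longleftrightarrow> \<phi> ` X \<in> \<I>'))"

(* The matroid of the columns of an integer matrix A with row index set R and column index
   set E: X is independent iff the family of columns indexed by X is linearly independent
   over the reals, so two equal columns form a dependent pair.  Explicit index sets are used
   instead of types because the number of rows is quantified in the notion of regularity. *)
definition vector_matroid :: "'i set \<Rightarrow> 'a set \<Rightarrow> ('i \<Rightarrow> 'a \<Rightarrow> int) \<Rightarrow> 'a set_system" where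
  "vector_matroid R E A = (E, {X. X \<subseteq> E \<and>
     (\<forall>c :: 'a \<Rightarrow> real. (\<forall>i\<in>R. (\<Sum>j\<in>X. c j * real_of_int (A i j)) = 0) \<longrightarrow> (\<forall>j\<in>X. c j = 0))})"

definition totally_unimodular :: "'i set \<Rightarrow> 'a set \<Rightarrow> ('i \<Rightarrow> 'a \<Rightarrow> int) \<Rightarrow> bool" where
  "totally_unimodular R E A \<longleftrightarrow>
     (\<forall>k f g. inj_on f {..<k} \<and> f ` {..<k} \<subseteq> R \<and> inj_on g {..<k} \<and> g ` {..<k} \<subseteq> E \<longrightarrow>
        Determinant.det (Matrix.mat k k (\<lambda>(i, j). A (f i) (g j))) \<in> {-1, 0, 1})"

definition regular_matroid :: "'a set_system \<Rightarrow> bool" where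
  "regular_matroid T \<longleftrightarrow> matroid T \<and>
     (\<exists>(m :: nat) A. totally_unimodular {..<m} (fst T) A \<and> T = vector_matroid {..<m} (fst T) A)"

definition matroid_of :: "int ^ 'n ^ 'r \<Rightarrow> 'n set_system" where
  "matroid_of M = vector_matroid UNIV UNIV (\<lambda>i j. M $ i $ j)"

end

theory Submission
  imports Defs
begin

text \<open>
  Choose a basis of columns of \<open>M\<close> containing a given column \<open>c\<close>. The corresponding maximal minor
  is \<open>\<plusminus>1\<close>, so Cramer's rule writes \<open>M = B A\<close> with \<open>B\<close> the unimodular basis matrix and \<open>A\<close> an
  integer matrix containing an identity submatrix; such an \<open>A\<close> is totally unimodular, because each
  of its minors extends to a maximal one by adding unit columns. In the coordinates given by \<open>B\<close>,
  the column \<open>c\<close> is a unit vector \<open>e\<^sub>k\<close>. If \<open>e\<^sub>k\<close> is a convex combination of signed columns of \<open>A\<close>,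
  all of these have \<open>k\<close>-th entry 1, and two of them cannot have opposite signs in another row, since
  this would give a \<open>2 \<times> 2\<close> minor \<open>\<plusminus>2\<close>; hence they all equal \<open>e\<^sub>k\<close>. So the vertices of the polytope
  are exactly the signed columns. A unimodular equivalence maps vertices to vertices, and comparing
  the sums of all vertices, which vanish by symmetry, shows that it has no translation part.
\<close>

section \<open>Maximal minors and selections of columns\<close>

abbreviation real_mat :: "int ^ 'n ^ 'r \<Rightarrow> real ^ 'n ^ 'r" where
  "real_mat \<equiv> map_matrix real_of_int"

definition select_columns :: "'a ^ 'n ^ 'r \<Rightarrow> ('k \<Rightarrow> 'n) \<Rightarrow> 'a ^ 'k ^ 'r" where
  "select_columns M f = (\<chi> i k. M $ i $ f k)"

lemma select_columns_nth [simp]: "select_columns M f $ i $ k = M $ i $ f k"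
  by (simp add: select_columns_def)

lemma det_real_mat: "Determinants.det (real_mat A) = of_int (Determinants.det A)"
  by (simp add: Determinants.det_def)

lemma real_mat_mult: "real_mat (A ** B) = real_mat A ** real_mat B"
  by (simp add: vec_eq_iff matrix_matrix_mult_def)

lemma column_real_mat_mult: "column j (real_mat (B ** A)) = real_mat B *v column j (real_mat A)"
  by (simp add: real_mat_mult vec_eq_iff column_def matrix_vector_mult_def matrix_matrix_mult_def)

lemma select_columns_mult: "select_columns (B ** A) h = B ** select_columns A h"
  by (simp add: vec_eq_iff matrix_matrix_mult_def)

lemma det_select_columns_not_inj:
  fixes M :: "'a::comm_ring_1 ^ 'n ^ 'r"
  assumes "\<not> inj f"
  shows "Determinants.det (select_columns M f) = 0"
proof -
  obtain k l where "k \<noteq> l" "f k = f l"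
    using assms by (auto simp: inj_def)
  then show ?thesis
    by (intro Determinants.det_identical_columns[of k l]) (auto simp: column_def)
qed

text \<open>Repeated columns make a minor vanish, so the bound holds for every selection
  \<open>f\<close>. Later arguments can therefore use selections whose injectivity is
  unclear.\<close>

lemma weakly_unimodular_det_cases:
  assumes "weakly_unimodular M"
  shows "Determinants.det (select_columns M f) \<in> {-1, 0, 1}"
  using assms det_select_columns_not_inj[of f M]
  unfolding weakly_unimodular_def select_columns_def by blast

section \<open>Standard form with respect to a basis of columns\<close>

text \<open>A nonzero column extends to a basis of the column space, and full rank makes the size of
  this basis equal to the number of rows.\<close>

lemma column_basis_exists:
  fixes M :: "int ^ 'n ^ 'r"
  assumes rank: "rank (real_mat M) = CARD('r)" and nz: "column j0 M \<noteq> 0"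
  obtains b where "inj b" "j0 \<in> range b" "Determinants.det (select_columns M b) \<noteq> 0"
proof -
  let ?c = "\<lambda>j. column j (real_mat M)"
  have cols: "columns (real_mat M) = range ?c"
    by (auto simp: columns_def)
  have "?c j0 \<noteq> 0"
    using nz by (auto simp: column_def vec_eq_iff)
  then have "independent {?c j0}"
    by simp
  then obtain B where B: "{?c j0} \<subseteq> B" "B \<subseteq> range ?c" "independent B" "range ?c \<subseteq> span B"
    using maximal_independent_subset_extend[of "{?c j0}" "range ?c"] by auto
  have "card B = dim (range ?c)"
    using B basis_card_eq_dim by blast
  then have cardB: "card B = CARD('r)"
    using rank by (simp add: column_rank_def cols)
  have finB: "finite B"
    by (rule finite_subset[OF B(2)]) simp
  obtain g :: "'r \<Rightarrow> real ^ 'r" where g: "bij_betw g UNIV B"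
    using finite_same_card_bij[of "UNIV :: 'r set" B] finB cardB by auto
  \<comment> \<open>Several indices may carry the same column here, so an arbitrary choice could
    miss \<open>j0\<close>; the case distinction forces \<open>j0\<close> into the range.\<close>
  define b where "b k = (if g k = ?c j0 then j0 else (SOME j. ?c j = g k))" for k
  have cb: "?c (b k) = g k" for k
  proof -
    have "g k \<in> range ?c"
      using g B(2) by (auto simp: bij_betw_def)
    then obtain j where "?c j = g k"
      by force
    then have "?c (SOME j. ?c j = g k) = g k"
      by (rule someI)
    then show ?thesis
      by (auto simp: b_def)
  qed
  have injb: "inj b"
    by (rule injI) (metis cb g bij_betw_def injD)
  have "?c j0 \<in> range g"
    using g B(1) by (auto simp: bij_betw_def)
  then have j0: "j0 \<in> range b"
    by (metis b_def rangeE rangeI)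
  have "columns (real_mat (select_columns M b)) = range (\<lambda>k. ?c (b k))"
    by (auto simp: columns_def column_def)
  also have "\<dots> = B"
    using g by (simp add: cb bij_betw_def)
  finally have "rank (real_mat (select_columns M b)) = CARD('r)"
    using B(3) cardB by (simp add: column_rank_def dim_eq_card_independent)
  then have "Determinants.det (real_mat (select_columns M b)) \<noteq> 0"
    using det_eq_0_rank[of "real_mat (select_columns M b)"] by simp
  then have "Determinants.det (select_columns M b) \<noteq> 0"
    by (simp add: det_real_mat)
  with injb j0 that show ?thesis
    by blast
qed

text \<open>By Cramer's rule the entries of the coordinate matrix are quotients of maximal minors of
  \<open>M\<close>. The denominator is 1 or -1, so they are integers.\<close>

lemma weakly_unimodular_standard_form:
  fixes M :: "int ^ 'n ^ 'r"
  assumes wu: "weakly_unimodular M" and nz: "Determinants.det (select_columns M b) \<noteq> 0"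
  obtains A where "M = select_columns M b ** A"
    and "weakly_unimodular A"
    and "\<And>k l. A $ k $ b l = (if k = l then 1 else 0)"
proof -
  let ?B = "select_columns M b"
  let ?d = "Determinants.det ?B"
  \<comment> \<open>The factor \<open>?d\<close> stands for division by \<open>?d\<close>, since
    \<open>?d\<close> is its own inverse.\<close>
  define A :: "int ^ 'n ^ 'r" where
    "A = (\<chi> k j. ?d * Determinants.det (select_columns M (b(k := j))))"
  have d: "?d = 1 \<or> ?d = -1"
    using weakly_unimodular_det_cases[OF wu, of b] nz by auto
  \<comment> \<open>Cramer's rule is applied over the real field; the resulting identity is pulled
    back to the integers afterwards.\<close>
  have dR: "Determinants.det (real_mat ?B) \<noteq> 0"
    using nz by (simp add: det_real_mat)
  have "real_mat ?B *v column j (real_mat A) = column j (real_mat M)" for j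
  proof -
    have "column j (real_mat A) $ k = Determinants.det
        (\<chi> i l. if l = k then column j (real_mat M) $ i else real_mat ?B $ i $ l) /
          Determinants.det (real_mat ?B)" for k
    proof -
      have "(\<chi> i l. if l = k then column j (real_mat M) $ i else real_mat ?B $ i $ l) =
          real_mat (select_columns M (b(k := j)))"
        by (simp add: vec_eq_iff column_def)
      then show ?thesis
        using d by (auto simp: det_real_mat column_def A_def)
    qed
    then show ?thesis
      unfolding cramer[OF dR] by (simp add: vec_eq_iff)
  qed
  then have "real_mat (?B ** A) = real_mat M"
    by (simp add: real_mat_mult vec_eq_iff matrix_matrix_mult_def matrix_vector_mult_def column_def)
  then have eq: "M = ?B ** A"
    by (simp add: vec_eq_iff)
  have "Determinants.det (select_columns A h) \<in> {-1, 0, 1}" for h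
  proof -
    have "?d * Determinants.det (select_columns A h) = Determinants.det (select_columns M h)"
      by (subst (2) eq) (simp add: select_columns_mult Determinants.det_mul)
    then show ?thesis
      using d weakly_unimodular_det_cases[OF wu, of h] by auto
  qed
  then have "weakly_unimodular A"
    by (simp add: weakly_unimodular_def select_columns_def)
  \<comment> \<open>Replacing column \<open>k\<close> of the basis matrix by column \<open>l\<close>
    gives that matrix back if \<open>k = l\<close>, and otherwise a matrix with a repeated
    column.\<close>
  moreover have "A $ k $ b l = (if k = l then 1 else 0)" for k l
  proof (cases "k = l")
    case True
    then show ?thesis
      using d by (auto simp: A_def)
  next
    case False
    then have "\<not> inj (b(k := b l))"
      by (auto simp: inj_def)
    then show ?thesis
      using False by (simp add: A_def det_select_columns_not_inj)
  qed
  ultimately show ?thesis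
    using that eq by blast
qed

section \<open>Total unimodularity of the standard form\<close>

lemma totally_unimodular_if_weakly_unimodular_with_identity:
  fixes A :: "int ^ 'n ^ 'r"
  assumes wu: "weakly_unimodular A"
    and unit: "\<And>k l. A $ k $ b l = (if k = l then 1 else 0)"
  shows "totally_unimodular UNIV UNIV (\<lambda>i j. A $ i $ j)"
  \<comment> \<open>The columns of a square submatrix are placed at its row indices and unit columns at the
    remaining ones; in the Leibniz formula only permutations fixing the latter survive.\<close>
  unfolding totally_unimodular_def
proof (intro allI impI, elim conjE)
  fix n :: nat and f :: "nat \<Rightarrow> 'r" and g :: "nat \<Rightarrow> 'n"
  assume f: "inj_on f {..<n}" and g: "inj_on g {..<n}"
  let ?S = "Matrix.mat n n (\<lambda>(i, j). A $ f i $ g j)"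
  let ?I = "{0..<n}"
  define F where "F = f ` ?I"
  define h where "h l = (if l \<in> F then g (inv_into ?I f l) else b l)" for l
  let ?T = "select_columns A h"
  have injf: "inj_on f ?I" and bijf: "bij_betw f ?I F"
    using f by (auto simp: F_def bij_betw_def lessThan_atLeast0)
  have hf: "h (f i) = g i" if "i < n" for i
    using that injf by (auto simp: h_def F_def)
  have T_out: "?T $ i $ l = (if i = l then 1 else 0)" if "l \<notin> F" for i l
    using that by (simp add: h_def unit)
  have "Determinants.det ?T =
      (\<Sum>p | p permutes UNIV. of_int (sign p) * (\<Prod>i\<in>UNIV. ?T $ i $ p i))"
    by (simp add: Determinants.det_def)
  also have "\<dots> = (\<Sum>p | p permutes F. of_int (sign p) * (\<Prod>i\<in>UNIV. ?T $ i $ p i))"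
  proof (rule sum.mono_neutral_right)
    show "{p. p permutes F} \<subseteq> {p. p permutes (UNIV :: 'r set)}"
      by (auto intro: permutes_subset)
    show "\<forall>p\<in>{p. p permutes UNIV} - {p. p permutes F}.
        of_int (sign p) * (\<Prod>i\<in>UNIV. ?T $ i $ p i) = 0"
    proof
      fix p assume "p \<in> {p. p permutes (UNIV :: 'r set)} - {p. p permutes F}"
      then have p: "p permutes UNIV" "\<not> p permutes F"
        by auto
      then obtain l where "l \<notin> F" "p l \<noteq> l"
        unfolding permutes_def by auto
      moreover obtain i where "p i = l"
        using p(1) by (metis permutes_def)
      ultimately have "?T $ i $ p i = 0"
        using T_out[of l i] by auto
      then have "(\<Prod>i\<in>UNIV. ?T $ i $ p i) = 0"
        by (intro prod_zero) auto
      then show "of_int (sign p) * (\<Prod>i\<in>UNIV. ?T $ i $ p i) = 0"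
        by simp
    qed
  qed simp
  also have "\<dots> = (\<Sum>p | p permutes F. of_int (sign p) * (\<Prod>i\<in>F. ?T $ i $ p i))"
  proof (rule sum.cong[OF refl])
    fix p assume "p \<in> {p. p permutes F}"
    then have "?T $ i $ p i = 1" if "i \<notin> F" for i
      using that T_out[of i i] by (auto simp: permutes_not_in)
    then have "(\<Prod>i\<in>UNIV. ?T $ i $ p i) = (\<Prod>i\<in>F. ?T $ i $ p i)"
      by (intro prod.mono_neutral_right) auto
    then show "of_int (sign p) * (\<Prod>i\<in>UNIV. ?T $ i $ p i) =
        of_int (sign p) * (\<Prod>i\<in>F. ?T $ i $ p i)"
      by simp
  qed
  \<comment> \<open>Conjugation with the bijection \<open>f\<close> turns permutations of
    \<open>?I\<close> into permutations of \<open>F\<close> and preserves signs.\<close>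
  also have "\<dots> = (\<Sum>q | q permutes ?I. of_int (sign q) * (\<Prod>i\<in>?I. A $ f i $ g (q i)))"
  proof (rule sum.reindex_bij_betw[symmetric, THEN trans, rotated])
    show "bij_betw (map_permutation ?I f) {q. q permutes ?I} {p. p permutes F}"
      using bij_betw_permutations[OF bijf] bijf
      by (simp add: map_permutation_def[abs_def] restrict_id_def[abs_def] bij_betw_def comp_def)
    show "(\<Sum>q | q permutes ?I. of_int (sign (map_permutation ?I f q)) *
            (\<Prod>i\<in>F. ?T $ i $ map_permutation ?I f q i)) =
        (\<Sum>q | q permutes ?I. of_int (sign q) * (\<Prod>i\<in>?I. A $ f i $ g (q i)))"
    proof (rule sum.cong[OF refl])
      fix q assume "q \<in> {q. q permutes ?I}"
      then have q: "q permutes ?I"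
        by simp
      have "(\<Prod>i\<in>F. ?T $ i $ map_permutation ?I f q i) =
          (\<Prod>i\<in>?I. ?T $ f i $ map_permutation ?I f q (f i))"
        unfolding F_def by (simp add: prod.reindex[OF injf])
      also have "\<dots> = (\<Prod>i\<in>?I. A $ f i $ g (q i))"
      proof (rule prod.cong[OF refl])
        fix i assume i: "i \<in> ?I"
        then have "q i < n"
          using permutes_in_image[OF q, of i] by simp
        then show "?T $ f i $ map_permutation ?I f q (f i) = A $ f i $ g (q i)"
          using map_permutation_apply[OF injf i] hf by simp
      qed
      finally show "of_int (sign (map_permutation ?I f q)) *
            (\<Prod>i\<in>F. ?T $ i $ map_permutation ?I f q i) =
          of_int (sign q) * (\<Prod>i\<in>?I. A $ f i $ g (q i))"
        using sign_map_permutation[OF injf q] by simp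
    qed
  qed
  also have "\<dots> = Determinant.det ?S"
    by (subst Determinant.det_def'[of _ n])
      (auto intro!: sum.cong prod.cong simp: permutes_in_image)
  \<comment> \<open>\<open>h\<close> need not be injective, because a chosen column
    \<open>g i\<close> may coincide with an added unit column \<open>b l\<close>; the bound for
    arbitrary selections covers this case.\<close>
  finally show "Determinant.det ?S \<in> {-1, 0, 1}"
    using weakly_unimodular_det_cases[OF wu, of h] by simp
qed

lemma totally_unimodular_entry:
  assumes "totally_unimodular R E A" "i \<in> R" "j \<in> E"
  shows "A i j \<in> {-1, 0, 1}"
proof -
  have "Determinant.det (Matrix.mat 1 1 (\<lambda>(x, y). A i j)) \<in> {-1, 0, 1}"
    using assms(1)[unfolded totally_unimodular_def, rule_format, of "\<lambda>_. i" 1 "\<lambda>_. j"] assms(2,3)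
    by (auto simp: inj_on_def)
  then show ?thesis
    by (simp add: det_single)
qed

lemma totally_unimodular_minor_2:
  assumes "totally_unimodular R E A" "i \<in> R" "i' \<in> R" "i \<noteq> i'" "j \<in> E" "j' \<in> E" "j \<noteq> j'"
  shows "A i j * A i' j' - A i j' * A i' j \<in> {-1, 0, 1}"
proof -
  define f where "f = (\<lambda>x::nat. if x = 0 then i else i')"
  define g where "g = (\<lambda>x::nat. if x = 0 then j else j')"
  have "inj_on f {..<2} \<and> f ` {..<2} \<subseteq> R \<and> inj_on g {..<2} \<and> g ` {..<2} \<subseteq> E"
    using assms(2-) by (auto simp: f_def g_def inj_on_def split: if_splits)
  then have "Determinant.det (Matrix.mat 2 2 (\<lambda>(x, y). A (f x) (g y))) \<in> {-1, 0, 1}"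
    using assms(1) unfolding totally_unimodular_def by blast
  moreover have "Determinant.det (Matrix.mat 2 2 (\<lambda>(x, y). A (f x) (g y))) =
      A i j * A i' j' - A i j' * A i' j"
  proof -
    have two: "{0..<2} = insert 0 {1::nat}"
      by auto
    have notin: "finite {1::nat}" "0 \<notin> {1::nat}"
      by auto
    show ?thesis
      by (subst Determinant.det_def'[of _ 2], simp, unfold two sum_over_permutations_insert[OF notin] permutes_sing)
        (simp add: f_def g_def sign_swap_id transpose_def)
  qed
  ultimately show ?thesis
    by simp
qed

text \<open>After scaling by \<open>t\<close> and \<open>t'\<close>, both columns have entry 1 in
  row \<open>i\<close>. Opposite nonzero entries in row \<open>i'\<close> would give a minor of
  absolute value 2. If \<open>j = j'\<close>, the two signs agree and the product is a
  square.\<close>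

lemma totally_unimodular_signs_agree:
  assumes tu: "totally_unimodular R E A" and i: "i \<in> R" "i' \<in> R" "i \<noteq> i'" and j: "j \<in> E" "j' \<in> E"
    and t: "t \<in> {1, -1}" "t' \<in> {1, -1}" and one: "t * A i j = 1" "t' * A i j' = 1"
  shows "0 \<le> (t * A i' j) * (t' * A i' j')"
proof (cases "j = j'")
  case True
  then show ?thesis
    using t one by (auto simp: mult.assoc[symmetric])
next
  case False
  then show ?thesis
    using totally_unimodular_minor_2[OF tu i j False] t one
      totally_unimodular_entry[OF tu i(2) j(1)] totally_unimodular_entry[OF tu i(2) j(2)]
    by auto
qed

text \<open>Provides coordinates in which a prescribed column is a unit vector. The vertex argument,
  regularity and simplicity all start from it.\<close>

lemma standard_form_at_column:
  fixes M :: "int ^ 'n ^ 'r"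
  assumes M: "full_rank_weakly_unimodular M" and nz: "column j0 M \<noteq> 0"
  obtains B :: "int ^ 'r ^ 'r" and A :: "int ^ 'n ^ 'r" and k0 where
    "M = B ** A" "Determinants.det B \<noteq> 0"
    "totally_unimodular UNIV UNIV (\<lambda>i j. A $ i $ j)"
    "\<And>k. A $ k $ j0 = (if k = k0 then 1 else 0)"
proof -
  have M': "rank (real_mat M) = CARD('r)" "weakly_unimodular M"
    using M by (auto simp: full_rank_weakly_unimodular_def)
  obtain b where b: "j0 \<in> range b" "Determinants.det (select_columns M b) \<noteq> 0"
    using column_basis_exists[OF M'(1) nz] by blast
  obtain k0 where k0: "j0 = b k0"
    using b(1) by blast
  obtain A where A: "M = select_columns M b ** A" "weakly_unimodular A"
      "\<And>k l. A $ k $ b l = (if k = l then 1 else 0)"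
    using weakly_unimodular_standard_form[OF M'(2) b(2)] by blast
  show ?thesis
    using that[OF A(1) b(2) totally_unimodular_if_weakly_unimodular_with_identity[OF A(2,3)]] A(3) k0 by blast
qed

section \<open>Vertices of the symmetric polytope\<close>

lemma columns_hcat_uminus:
  fixes M :: "int ^ 'n ^ 'r"
  shows "columns (real_mat (hcat M (- M))) =
     range (\<lambda>j. column j (real_mat M)) \<union> uminus ` range (\<lambda>j. column j (real_mat M))"
proof -
  have "column (Inl j) (real_mat (hcat M (- M))) = column j (real_mat M)"
    and "column (Inr j) (real_mat (hcat M (- M))) = - column j (real_mat M)" for j
    by (simp_all add: hcat_def column_def vec_eq_iff)
  moreover have "columns X = (\<lambda>i. column i X) ` (range Inl \<union> range Inr)" for X :: "real ^ ('n + 'n) ^ 'r"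
    unfolding columns_def UNIV_sum[symmetric] by auto
  ultimately show ?thesis
    by (simp add: image_Un image_image)
qed

lemma column_not_in_hull_of_others:
  fixes M :: "int ^ 'n ^ 'r"
  assumes M: "full_rank_weakly_unimodular M" and nz: "\<And>j. column j M \<noteq> 0"
    and a: "a \<in> columns (real_mat (hcat M (- M)))"
  shows "a \<notin> convex hull (columns (real_mat (hcat M (- M))) - {a})"
proof
  let ?c = "\<lambda>j. column j (real_mat M)"
  let ?V = "columns (real_mat (hcat M (- M)))"
  let ?W = "?V - {a}"
  assume hull: "a \<in> convex hull ?W"
  have V: "\<exists>j. \<exists>t\<in>{1, -1::int}. d = of_int t *\<^sub>R ?c j" if "d \<in> ?V" for d
    using that unfolding columns_hcat_uminus by force
  obtain j0 s where s: "s \<in> {1, -1::int}" "a = of_int s *\<^sub>R ?c j0"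
    using V[OF a] by blast
  obtain B A k0 where BA: "M = B ** A" "Determinants.det B \<noteq> 0"
      and tu: "totally_unimodular UNIV UNIV (\<lambda>i j. A $ i $ j)"
      and A0: "\<And>k. A $ k $ j0 = (if k = k0 then 1 else 0)"
    using standard_form_at_column[OF M nz, of j0] by blast
  have "invertible (real_mat B)"
    using BA(2) by (simp add: invertible_det_nz det_real_mat)
  then obtain G where G: "G ** real_mat B = mat 1" "real_mat B ** G = mat 1"
    by (auto simp: invertible_def)
  \<comment> \<open>\<open>y\<close> passes to the coordinates given by \<open>B\<close> and
    multiplies by the sign of \<open>a\<close>. It sends \<open>a\<close> to the unit vector at
    \<open>k0\<close> and signed columns of \<open>M\<close> to signed columns of
    \<open>A\<close>.\<close>
  define y where "y x = of_int s *\<^sub>R (G *v x)" for x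
  have y_inj: "x = x'" if "y x = y x'" for x x'
  proof -
    have "G *v x = G *v x'"
      using that s(1) by (auto simp: y_def)
    then have "real_mat B *v (G *v x) = real_mat B *v (G *v x')"
      by simp
    then show ?thesis
      by (simp add: matrix_vector_mul_assoc G)
  qed
  have Gc: "(G *v ?c j) $ k = of_int (A $ k $ j)" for j k
  proof -
    have "?c j = real_mat B *v column j (real_mat A)"
      by (simp add: BA(1) column_real_mat_mult)
    then have "G *v ?c j = column j (real_mat A)"
      by (simp add: matrix_vector_mul_assoc G)
    then show ?thesis
      by (simp add: column_def)
  qed
  have yV: "\<exists>j. \<exists>t\<in>{1, -1::int}. \<forall>k. y d $ k = of_int (t * A $ k $ j)" if d: "d \<in> ?V" for d
  proof -
    obtain j t where "t \<in> {1, -1}" "d = of_int t *\<^sub>R ?c j"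
      using V[OF d] by blast
    then have "s * t \<in> {1, -1}" "\<forall>k. y d $ k = of_int ((s * t) * A $ k $ j)"
      using s(1) by (auto simp: y_def matrix_vector_mult_scaleR Gc)
    then show ?thesis
      by blast
  qed
  have ya: "y a $ k = (if k = k0 then 1 else 0)" for k
    using s by (auto simp: y_def matrix_vector_mult_scaleR Gc A0)
  have y_le: "y d $ k \<le> 1" if d: "d \<in> ?V" for d k
  proof -
    obtain j t where t: "t \<in> {1, -1}" "y d $ k = of_int (t * A $ k $ j)"
      using yV[OF d] by blast
    have "A $ k $ j \<in> {-1, 0, 1}"
      using totally_unimodular_entry[OF tu] by blast
    with t show ?thesis
      by auto
  qed
  have agree: "0 \<le> y d $ k * y d' $ k"
    if dd': "d \<in> ?V" "d' \<in> ?V" and eqs: "k \<noteq> k0" "y d $ k0 = 1" "y d' $ k0 = 1" for d d' k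
  proof -
    obtain j t where t: "t \<in> {1, -1}" "\<forall>k. y d $ k = of_int (t * A $ k $ j)"
      using yV[OF dd'(1)] by blast
    obtain j' t' where t': "t' \<in> {1, -1}" "\<forall>k. y d' $ k = of_int (t' * A $ k $ j')"
      using yV[OF dd'(2)] by blast
    have "real_of_int (t * A $ k0 $ j) = 1" "real_of_int (t' * A $ k0 $ j') = 1"
      using eqs(2,3) t(2) t'(2) by auto
    then have "t * A $ k0 $ j = 1" "t' * A $ k0 $ j' = 1"
      by linarith+
    then have "0 \<le> (t * A $ k $ j) * (t' * A $ k $ j')"
      using totally_unimodular_signs_agree[OF tu, of k0 k j j' t t'] eqs(1) t(1) t'(1) by auto
    then show ?thesis
      using t(2) t'(2) by (metis of_int_0_le_iff of_int_mult)
  qed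
  have finW: "finite ?W"
    by (simp add: columns_hcat_uminus)
  obtain u where u: "\<forall>x\<in>?W. 0 \<le> u x" "sum u ?W = 1" "(\<Sum>x\<in>?W. u x *\<^sub>R x) = a"
    using hull unfolding convex_hull_finite[OF finW] by blast
  have coord: "(\<Sum>x\<in>?W. u x * y x $ k) = y a $ k" for k
  proof -
    have "y (\<Sum>x\<in>?W. u x *\<^sub>R x) = (\<Sum>x\<in>?W. u x *\<^sub>R y x)"
      by (simp add: y_def matrix_vector_mult_scaleR linear_sum[OF matrix_vector_mul_linear]
          scaleR_sum_right mult.commute)
    then have "y a = (\<Sum>x\<in>?W. u x *\<^sub>R y x)"
      by (simp only: u(3))
    then show ?thesis
      by (simp add: sum_component)
  qed
  \<comment> \<open>A weighted average of numbers at most 1 equals 1 only if every number with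
    nonzero weight is 1.\<close>
  have "(\<Sum>x\<in>?W. u x * (1 - y x $ k0)) = 0"
    using coord[of k0] ya u(2) by (simp add: algebra_simps sum_subtractf)
  then have "\<forall>x\<in>?W. u x * (1 - y x $ k0) = 0"
    using u(1) y_le by (subst (asm) sum_nonneg_eq_0_iff[OF finW]) auto
  then have face: "y x $ k0 = 1" if "x \<in> ?W" "u x \<noteq> 0" for x
    using that by auto
  obtain d where d: "d \<in> ?W" "u d \<noteq> 0"
    using u(2) by (metis sum.neutral zero_neq_one)
  \<comment> \<open>Coordinate \<open>k\<close> of the combination is 0. Multiplied by
    \<open>y d $ k\<close>, all its summands become nonnegative by sign agreement, hence all vanish;
    the summand of \<open>d\<close> is \<open>u d\<close> times the square of
    \<open>y d $ k\<close>.\<close>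
  have "y d $ k = 0" if k: "k \<noteq> k0" for k
  proof -
    have "(\<Sum>x\<in>?W. u x * (y d $ k * y x $ k)) = y d $ k * (\<Sum>x\<in>?W. u x * y x $ k)"
      by (simp add: sum_distrib_left algebra_simps)
    also have "\<dots> = 0"
      using coord[of k] ya k by simp
    finally have "(\<Sum>x\<in>?W. u x * (y d $ k * y x $ k)) = 0" .
    moreover have "0 \<le> u x * (y d $ k * y x $ k)" if x: "x \<in> ?W" for x
    proof (cases "u x = 0")
      case False
      then have "0 \<le> y d $ k * y x $ k"
        using agree[OF _ _ k face[OF d] face[OF x False]] d(1) x by blast
      then show ?thesis
        using u(1) x by simp
    qed simp
    ultimately have "\<forall>x\<in>?W. u x * (y d $ k * y x $ k) = 0"
      by (subst (asm) sum_nonneg_eq_0_iff[OF finW]) auto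
    then show ?thesis
      using d by fastforce
  qed
  then have "y d = y a"
    using face[OF d] ya by (simp add: vec_eq_iff)
  then show False
    using y_inj[of d a] d(1) by blast
qed

text \<open>No generator lies in the hull of the others, so the finite generating set is exactly the
  set of extreme points.\<close>

lemma extreme_points_sym_polytope:
  fixes M :: "int ^ 'n ^ 'r"
  assumes "full_rank_weakly_unimodular M" "irredundant_columns M"
  shows "{x. x extreme_point_of sym_polytope M} = columns (real_mat (hcat M (- M)))"
proof -
  have "finite (columns (real_mat (hcat M (- M))))"
    by (simp add: columns_hcat_uminus)
  then show ?thesis
    unfolding sym_polytope_def using assms column_not_in_hull_of_others[of M]
    by (subst extreme_point_of_convex_hull_convex_independent)
      (auto simp: irredundant_columns_def finite_imp_compact)
qed

text \<open>Extreme points are the singleton faces, and injective linear maps and translations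
  transport faces.\<close>

lemma extreme_points_of_affine_image:
  fixes f :: "'a::euclidean_space \<Rightarrow> 'b::euclidean_space"
  assumes "linear f" "inj f"
  shows "{x. x extreme_point_of (\<lambda>x. f x + v) ` S} = (\<lambda>x. f x + v) ` {x. x extreme_point_of S}"
proof -
  have img: "(\<lambda>x. f x + v) ` T = (\<lambda>x. v + x) ` f ` T" for T
    by (auto simp: image_image add.commute)
  have "f x extreme_point_of f ` S \<longleftrightarrow> x extreme_point_of S" for x
    using face_of_linear_image[OF assms, of "{x}" S] by (simp add: face_of_singleton)
  moreover have "x \<in> f ` S" if "x extreme_point_of f ` S" for x
    using that by (simp add: extreme_point_of_def)
  ultimately have "{x. x extreme_point_of f ` S} = f ` {x. x extreme_point_of S}"
    by blast
  then show ?thesis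
    unfolding img extreme_points_of_translation by simp
qed

section \<open>The column matroid: axioms, regularity and simplicity\<close>

text \<open>Links independence of indexed families, used by \<open>vector_matroid\<close>, with
  \<open>independent\<close> for sets. Injectivity accounts for repeated vectors, which a set cannot
  see.\<close>

lemma scaleR_family_independent_iff:
  fixes v :: "'b \<Rightarrow> 'a::real_vector"
  assumes fin: "finite X"
  shows "(\<forall>c. (\<Sum>j\<in>X. c j *\<^sub>R v j) = 0 \<longrightarrow> (\<forall>j\<in>X. c j = 0)) \<longleftrightarrow>
    inj_on v X \<and> independent (v ` X)" (is "?L \<longleftrightarrow> ?R")
proof
  assume L: ?L
  have inj: "inj_on v X"
  proof (rule inj_onI, rule ccontr)
    fix i j assume ij: "i \<in> X" "j \<in> X" "v i = v j" "i \<noteq> j"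
    \<comment> \<open>Coefficients 1 at \<open>i\<close> and -1 at \<open>j\<close> form a
      nontrivial relation between equal vectors.\<close>
    let ?c = "\<lambda>k. (if k = i then 1 else 0) - (if k = j then 1 else 0) :: real"
    have "(\<Sum>k\<in>X. ?c k *\<^sub>R v k) =
        (\<Sum>k\<in>X. if k = i then v k else 0) - (\<Sum>k\<in>X. if k = j then v k else 0)"
      unfolding sum_subtractf[symmetric] by (rule sum.cong) auto
    also have "\<dots> = 0"
      using ij fin by simp
    finally have "?c i = 0"
      using L[rule_format, of ?c i] ij(1) by simp
    then show False
      using ij(4) by simp
  qed
  have "independent (v ` X)"
  proof (rule independent_if_scalars_zero)
    fix f x assume "(\<Sum>x\<in>v ` X. f x *\<^sub>R x) = 0" and x: "x \<in> v ` X"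
    then have "(\<Sum>j\<in>X. f (v j) *\<^sub>R v j) = 0"
      by (simp add: sum.reindex[OF inj])
    then have "\<forall>j\<in>X. f (v j) = 0"
      using L[rule_format, of "\<lambda>j. f (v j)"] by blast
    then show "f x = 0"
      using x by blast
  qed (use fin in simp)
  with inj show ?R ..
next
  assume R: ?R
  show ?L
  proof (intro allI impI ballI)
    fix c j assume sum: "(\<Sum>j\<in>X. c j *\<^sub>R v j) = 0" and j: "j \<in> X"
    have inj: "inj_on v X"
      using R ..
    let ?u = "\<lambda>x. c (inv_into X v x)"
    have "(\<Sum>x\<in>v ` X. ?u x *\<^sub>R x) = (\<Sum>j\<in>X. c j *\<^sub>R v j)"
      by (simp add: sum.reindex[OF inj] inv_into_f_f[OF inj])
    then have "?u (v j) = 0"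
      using R sum j fin independentD[of "v ` X" "v ` X" ?u "v j"] by auto
    then show "c j = 0"
      using j inj by simp
  qed
qed

lemma matroid_of_independent_iff:
  fixes M :: "int ^ 'n ^ 'r"
  shows "X \<in> snd (matroid_of M) \<longleftrightarrow>
    (\<forall>c. (\<Sum>j\<in>X. c j *\<^sub>R column j (real_mat M)) = 0 \<longrightarrow> (\<forall>j\<in>X. c j = 0))"
  by (simp add: matroid_of_def vector_matroid_def vec_eq_iff column_def)

lemma fst_matroid_of [simp]: "fst (matroid_of M) = UNIV"
  by (simp add: matroid_of_def vector_matroid_def)

lemma matroid_matroid_of: "matroid (matroid_of (M :: int ^ 'n ^ 'r))"
proof -
  let ?v = "\<lambda>j. column j (real_mat M)"
  let ?I = "snd (matroid_of M)"
  have ind: "X \<in> ?I \<longleftrightarrow> inj_on ?v X \<and> independent (?v ` X)" for X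
    unfolding matroid_of_independent_iff by (rule scaleR_family_independent_iff) simp
  have "\<exists>y\<in>Y - X. insert y X \<in> ?I" if X: "X \<in> ?I" and Y: "Y \<in> ?I" and less: "card X < card Y" for X Y
  proof -
    have "card (?v ` X) < card (?v ` Y)"
      using X Y less by (simp add: ind card_image)
    \<comment> \<open>Augmentation follows from the Steinitz bound: an independent set inside the
      span of \<open>?v\<close> X\<open>has at most as many elements as\<close>?v
      \<open>X\<close>.\<close>
    then have "\<not> ?v ` Y \<subseteq> span (?v ` X)"
      using independent_span_bound[of "?v ` X" "?v ` Y"] Y by (auto simp: ind)
    then obtain y where y: "y \<in> Y" "?v y \<notin> span (?v ` X)"
      by blast
    then have notin: "?v y \<notin> ?v ` X"
      by (meson span_base)
    then have "y \<notin> X" "inj_on ?v (insert y X)"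
      using X by (auto simp: ind)
    moreover have "independent (?v ` insert y X)"
      using X y(2) by (simp add: ind independent_insertI)
    ultimately show ?thesis
      using y(1) by (auto simp: ind)
  qed
  moreover have "{} \<in> ?I"
    by (simp add: matroid_of_independent_iff)
  moreover have "Y \<in> ?I" if "X \<in> ?I" "Y \<subseteq> X" for X Y
    using that by (metis ind inj_on_subset image_mono independent_mono)
  ultimately have "matroid (UNIV, ?I)"
    by (auto simp: matroid_def)
  then show ?thesis
    by (metis fst_matroid_of prod.collapse)
qed

text \<open>An injective linear map neither creates nor destroys linear relations among the
  columns.\<close>

lemma matroid_of_mult:
  fixes B :: "int ^ 'r ^ 'r" and A :: "int ^ 'n ^ 'r"
  assumes B: "inj ((*v) (real_mat B))"
  shows "matroid_of (B ** A) = matroid_of A"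
proof -
  have "(\<Sum>j\<in>X. c j *\<^sub>R column j (real_mat (B ** A))) =
      real_mat B *v (\<Sum>j\<in>X. c j *\<^sub>R column j (real_mat A))" for c X
    by (simp add: column_real_mat_mult linear_sum[OF matrix_vector_mul_linear]
        matrix_vector_mult_scaleR)
  moreover have "real_mat B *v x = 0 \<longleftrightarrow> x = 0" for x
    using B by (metis injD matrix_vector_mult_0_right)
  ultimately have "snd (matroid_of (B ** A)) = snd (matroid_of A)"
    by (auto simp: matroid_of_independent_iff)
  then show ?thesis
    by (simp add: prod_eq_iff)
qed

lemma inj_real_mat_if_det_nonzero:
  assumes "Determinants.det B \<noteq> 0"
  shows "inj ((*v) (real_mat B))"
  using assms by (intro inj_matrix_vector_mult) (simp add: invertible_det_nz det_real_mat)

text \<open>Used to number the rows by naturals, as \<open>regular_matroid\<close> demands.\<close>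

lemma totally_unimodular_reindex_rows:
  assumes "totally_unimodular R E A" "inj_on e R'" "e ` R' \<subseteq> R"
  shows "totally_unimodular R' E (\<lambda>i. A (e i))"
  unfolding totally_unimodular_def
proof (intro allI impI, elim conjE)
  fix k :: nat and f g
  assume "inj_on f {..<k}" "f ` {..<k} \<subseteq> R'" "inj_on g {..<k}" "g ` {..<k} \<subseteq> E"
  moreover from this have "inj_on (e \<circ> f) {..<k}" "(e \<circ> f) ` {..<k} \<subseteq> R"
    using assms(2,3) by (auto intro: comp_inj_on inj_on_subset)
  ultimately have "Determinant.det (Matrix.mat k k (\<lambda>(i, j). A ((e \<circ> f) i) (g j))) \<in> {-1, 0, 1}"
    using assms(1) unfolding totally_unimodular_def by blast
  then show "Determinant.det (Matrix.mat k k (\<lambda>(i, j). A (e (f i)) (g j))) \<in> {-1, 0, 1}"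
    by simp
qed

text \<open>The coordinate matrix \<open>A\<close> of a standard form is totally unimodular and
  represents the same matroid as \<open>M\<close>, because \<open>B\<close> is nonsingular.\<close>

lemma regular_matroid_of:
  fixes M :: "int ^ 'n ^ 'r"
  assumes M: "full_rank_weakly_unimodular M" and irr: "irredundant_columns M"
  shows "regular_matroid (matroid_of M)"
proof -
  obtain B :: "int ^ 'r ^ 'r" and A where BA: "M = B ** A" "Determinants.det B \<noteq> 0"
      and tu: "totally_unimodular UNIV UNIV (\<lambda>i j. A $ i $ j)"
    using standard_form_at_column[OF M] irr unfolding irredundant_columns_def by metis
  obtain e :: "nat \<Rightarrow> 'r" where e: "bij_betw e {..<CARD('r)} UNIV"
    using ex_bij_betw_nat_finite[of "UNIV :: 'r set"] by (auto simp: atLeast0LessThan)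
  have "totally_unimodular {..<CARD('r)} UNIV (\<lambda>i j. A $ e i $ j)"
    using totally_unimodular_reindex_rows[OF tu, of e "{..<CARD('r)}"] e
    by (auto simp: bij_betw_def)
  moreover have "matroid_of M = vector_matroid {..<CARD('r)} UNIV (\<lambda>i j. A $ e i $ j)"
  proof -
    have "(\<forall>i\<in>{..<CARD('r)}. (\<Sum>j\<in>X. c j * real_of_int (A $ e i $ j)) = 0) \<longleftrightarrow>
        (\<forall>i. (\<Sum>j\<in>X. c j * real_of_int (A $ i $ j)) = 0)" for X c
    proof -
      let ?Q = "\<lambda>i. (\<Sum>j\<in>X. c j * real_of_int (A $ i $ j)) = 0"
      have "(\<forall>i\<in>{..<CARD('r)}. ?Q (e i)) \<longleftrightarrow> (\<forall>i\<in>e ` {..<CARD('r)}. ?Q i)"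
        by blast
      also have "\<dots> \<longleftrightarrow> (\<forall>i. ?Q i)"
        using e by (simp add: bij_betw_def)
      finally show ?thesis .
    qed
    then have "matroid_of A = vector_matroid {..<CARD('r)} UNIV (\<lambda>i j. A $ e i $ j)"
      unfolding matroid_of_def vector_matroid_def by simp
    then show ?thesis
      using BA(1) matroid_of_mult[OF inj_real_mat_if_det_nonzero[OF BA(2)], of A] by simp
  qed
  ultimately show ?thesis
    unfolding regular_matroid_def using matroid_matroid_of[of M] by (metis fst_matroid_of)
qed

text \<open>It suffices that singletons and pairs are independent. A column dependent on column
  \<open>i\<close> is, in coordinates where column \<open>i\<close> is a unit vector, a multiple of
  it by -1, 0 or 1, which irredundancy excludes.\<close>

lemma simple_matroid_of:
  fixes M :: "int ^ 'n ^ 'r"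
  assumes M: "full_rank_weakly_unimodular M" and irr: "irredundant_columns M"
  shows "simple_matroid (matroid_of M)"
proof -
  let ?v = "\<lambda>j. column j (real_mat M)"
  have nz: "column j M \<noteq> 0" for j
    using irr by (simp add: irredundant_columns_def)
  then have vnz: "?v j \<noteq> 0" for j
    by (auto simp: column_def vec_eq_iff)
  have single: "{j} \<in> snd (matroid_of M)" for j
    using vnz[of j] by (auto simp: matroid_of_independent_iff)
  have pair: "{i, j} \<in> snd (matroid_of M)" if ij: "i \<noteq> j" for i j
    unfolding matroid_of_independent_iff
  proof (intro allI impI)
    fix c assume "(\<Sum>l\<in>{i, j}. c l *\<^sub>R ?v l) = 0"
    then have sum: "c i *\<^sub>R ?v i + c j *\<^sub>R ?v j = 0"
      using ij by simp
    obtain B A k0 where BA: "M = B ** A" "Determinants.det B \<noteq> 0"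
      and tu: "totally_unimodular UNIV UNIV (\<lambda>i j. A $ i $ j)"
      and A0: "\<And>k. A $ k $ i = (if k = k0 then 1 else 0)"
      using standard_form_at_column[OF M nz, of i] by blast
    have "real_mat B *v (c i *\<^sub>R column i (real_mat A) + c j *\<^sub>R column j (real_mat A)) = 0"
    proof -
      have "?v l = real_mat B *v column l (real_mat A)" for l
        by (simp add: BA(1) column_real_mat_mult)
      then show ?thesis
        using sum by (simp add: matrix_vector_right_distrib matrix_vector_mult_scaleR)
    qed
    then have "c i *\<^sub>R column i (real_mat A) + c j *\<^sub>R column j (real_mat A) = 0"
      using inj_real_mat_if_det_nonzero[OF BA(2)] by (metis injD matrix_vector_mult_0_right)
    then have eq: "c i * of_int (A $ k $ i) + c j * of_int (A $ k $ j) = 0" for k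
      by (simp add: vec_eq_iff column_def)
    have "c j = 0"
    proof (rule ccontr)
      assume "c j \<noteq> 0"
      \<comment> \<open>Column \<open>i\<close> of \<open>A\<close> vanishes outside row
        \<open>k0\<close>, so there the relation involves only \<open>c j\<close> and column
        \<open>j\<close>.\<close>
      then have off: "A $ k $ j = 0" if "k \<noteq> k0" for k
        using eq[of k] that by (simp add: A0)
      have "M $ l $ j = A $ k0 $ j * M $ l $ i" for l
      proof -
        have "M $ l $ j = (\<Sum>k\<in>UNIV. B $ l $ k * A $ k $ j)"
          by (simp add: BA(1) matrix_matrix_mult_def)
        also have "\<dots> = (\<Sum>k\<in>UNIV. B $ l $ k * (A $ k0 $ j * A $ k $ i))"
          by (rule sum.cong[OF refl]) (simp add: A0 off)
        also have "\<dots> = A $ k0 $ j * M $ l $ i"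
          by (simp add: BA(1) matrix_matrix_mult_def sum_distrib_left mult.left_commute)
        finally show ?thesis .
      qed
      then have "column j M = A $ k0 $ j *s column i M"
        by (simp add: vec_eq_iff column_def)
      moreover have "A $ k0 $ j \<in> {-1, 0, 1}"
        using totally_unimodular_entry[OF tu] by blast
      ultimately have "column j M \<in> {- column i M, 0, column i M}"
        by (auto simp: vec_eq_iff)
      then show False
        using irr ij nz[of j] by (auto simp: irredundant_columns_def)
    qed
    then show "\<forall>l\<in>{i, j}. c l = 0"
      using sum vnz by auto
  qed
  have "card C \<noteq> 1 \<and> card C \<noteq> 2" if C: "circuit (matroid_of M) C" for C
  proof -
    have dep: "C \<notin> snd (matroid_of M)"
      using C by (cases "matroid_of M") (simp add: circuit_def)
    have "card C \<noteq> 1"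
      using dep single by (metis card_1_singletonE)
    moreover have "card C \<noteq> 2"
      using dep pair by (metis card_2_iff)
    ultimately show ?thesis ..
  qed
  then show ?thesis
    by (simp add: simple_matroid_def matroid_matroid_of)
qed

text \<open>Relations among columns of \<open>N\<close> and of \<open>M\<close> correspond by
  relabelling the coefficients along \<sigma> and multiplying them by the signs, an invertible
  operation.\<close>

lemma matroid_of_signed_permutation:
  fixes M N :: "int ^ 'n ^ 'r"
  assumes \<sigma>: "bij \<sigma>" and s: "\<And>j. s j \<in> {1, -1}" and N: "\<And>i j. N $ i $ j = s j * M $ i $ \<sigma> j"
  shows "matroid_isomorphic (matroid_of M) (matroid_of N)"
proof -
  \<comment> \<open>Column \<open>j\<close> of \<open>N\<close> comes from column
    \<open>\<sigma> j\<close> of \<open>M\<close>, so the isomorphism from \<open>M\<close> to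
    \<open>N\<close> is the inverse of \<sigma>.\<close>
  define \<tau> where "\<tau> = inv_into UNIV \<sigma>"
  have *: "Y \<in> snd (matroid_of N) \<longleftrightarrow> \<sigma> ` Y \<in> snd (matroid_of M)" for Y
  proof -
    let ?m = "\<lambda>j. column j (real_mat M)"
    have inj: "inj_on \<sigma> Y"
      using \<sigma> by (meson bij_is_inj inj_on_subset subset_UNIV)
    have inv: "\<tau> (\<sigma> j) = j" for j
      using \<sigma> by (simp add: \<tau>_def bij_is_inj)
    have ss: "s j * s j = 1" for j
      using s[of j] by auto
    have snz: "s j \<noteq> 0" for j
      using s[of j] by auto
    have col: "column j (real_mat N) = of_int (s j) *\<^sub>R ?m (\<sigma> j)" for j
      by (simp add: vec_eq_iff column_def N)
    show ?thesis
      unfolding matroid_of_independent_iff sum.reindex[OF inj] col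
    proof (intro iffI allI impI)
      fix c
      assume L: "\<forall>c. (\<Sum>j\<in>Y. c j *\<^sub>R of_int (s j) *\<^sub>R ?m (\<sigma> j)) = 0 \<longrightarrow> (\<forall>j\<in>Y. c j = 0)"
        and c: "sum ((\<lambda>j. c j *\<^sub>R ?m j) \<circ> \<sigma>) Y = 0"
      have "(\<Sum>j\<in>Y. (c (\<sigma> j) * of_int (s j)) *\<^sub>R of_int (s j) *\<^sub>R ?m (\<sigma> j)) = 0"
        using c by (simp add: mult.assoc ss flip: of_int_mult)
      then have "\<forall>j\<in>Y. c (\<sigma> j) * of_int (s j) = 0"
        using L[rule_format, of "\<lambda>j. c (\<sigma> j) * of_int (s j)"] by blast
      then show "\<forall>j\<in>\<sigma> ` Y. c j = 0"
        using snz by simp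
    next
      fix c
      assume R: "\<forall>c. sum ((\<lambda>j. c j *\<^sub>R ?m j) \<circ> \<sigma>) Y = 0 \<longrightarrow> (\<forall>j\<in>\<sigma> ` Y. c j = 0)"
        and c: "(\<Sum>j\<in>Y. c j *\<^sub>R of_int (s j) *\<^sub>R ?m (\<sigma> j)) = 0"
      have "sum ((\<lambda>j. (c (\<tau> j) * of_int (s (\<tau> j))) *\<^sub>R ?m j) \<circ> \<sigma>) Y = 0"
        using c by (simp add: inv)
      then have "\<forall>j\<in>\<sigma> ` Y. c (\<tau> j) * of_int (s (\<tau> j)) = 0"
        using R[rule_format, of "\<lambda>j. c (\<tau> j) * of_int (s (\<tau> j))"] by blast
      then show "\<forall>j\<in>Y. c j = 0"
        using snz by (simp add: inv)
    qed
  qed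
  have "X \<in> snd (matroid_of M) \<longleftrightarrow> \<tau> ` X \<in> snd (matroid_of N)" for X
    unfolding * using \<sigma> by (simp add: \<tau>_def image_image bij_is_surj surj_f_inv_f)
  then have "matroid_isomorphic (UNIV, snd (matroid_of M)) (UNIV, snd (matroid_of N))"
    unfolding matroid_isomorphic_def using bij_imp_bij_inv[OF \<sigma>, folded \<tau>_def] by blast
  then show ?thesis
    by (metis fst_matroid_of prod.collapse)
qed

section \<open>From equivalent polytopes to equivalent matrices\<close>

theorem theorem4p5:
  fixes M N :: "int ^ 'n ^ 'r"
  assumes "CARD('r) \<le> CARD('n)"
    and "full_rank_weakly_unimodular M" and "irredundant_columns M"
    and "full_rank_weakly_unimodular N" and "irredundant_columns N"
    and "unimodularly_equivalent (sym_polytope M) (sym_polytope N)"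
  shows "(\<exists>(F :: int ^ 'r ^ 'r) (P :: int ^ 'n ^ 'n).
            invertible F \<and> signed_permutation_matrix P \<and> N = F ** M ** P) \<and>
         matroid_isomorphic (matroid_of M) (matroid_of N) \<and>
         simple_matroid (matroid_of M) \<and> regular_matroid (matroid_of M) \<and>
         simple_matroid (matroid_of N) \<and> regular_matroid (matroid_of N)"
proof -
  let ?V = "\<lambda>M :: int ^ 'n ^ 'r. columns (real_mat (hcat M (- M)))"
  obtain F :: "int ^ 'r ^ 'r" and v :: "int ^ 'r" where F: "invertible F"
      and img: "sym_polytope N =
        (\<lambda>x. real_mat F *v x + (\<chi> i. real_of_int (v $ i))) ` sym_polytope M"
    using assms(6) unfolding unimodularly_equivalent_def by blast
  define w :: "real ^ 'r" where "w = (\<chi> i. real_of_int (v $ i))"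
  obtain G where G: "F ** G = mat 1" "G ** F = mat 1"
    using F by (auto simp: invertible_def)
  have "real_mat G ** real_mat F = mat 1"
    unfolding real_mat_mult[symmetric] G by (simp add: vec_eq_iff mat_def)
  then have injF: "inj ((*v) (real_mat F))"
    by (metis matrix_left_invertible_injective)
  have VN: "?V N = (\<lambda>x. real_mat F *v x + w) ` ?V M"
    using extreme_points_of_affine_image[OF matrix_vector_mul_linear injF, of w "sym_polytope M"]
    unfolding img[folded w_def, symmetric] extreme_points_sym_polytope[OF assms(2,3)]
      extreme_points_sym_polytope[OF assms(4,5)] .
  \<comment> \<open>Negation permutes the vertex set, so the vertex sum equals its own
    negative.\<close>
  have sum0: "\<Sum>(?V K) = 0" for K
  proof -
    have "uminus ` ?V K = ?V K"
      unfolding columns_hcat_uminus by (simp add: image_Un image_image Un_commute)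
    then have "\<Sum>(?V K) = (\<Sum>x\<in>uminus ` ?V K. x)"
      by simp
    also have "\<dots> = (\<Sum>x\<in>?V K. - x)"
      by (subst sum.reindex) auto
    finally have "\<Sum>(?V K) = - \<Sum>(?V K)"
      by (simp add: sum_negf)
    then show ?thesis
      by (metis add.right_inverse scaleR_half_double scaleR_zero_right)
  qed
  have "w = 0"
  proof -
    have "inj_on (\<lambda>x. real_mat F *v x + w) (?V M)"
      using injF by (auto simp: inj_on_def)
    then have "\<Sum>(?V N) = (\<Sum>x\<in>?V M. real_mat F *v x + w)"
      unfolding VN by (simp add: sum.reindex)
    also have "\<dots> = real_mat F *v \<Sum>(?V M) + of_nat (card (?V M)) *\<^sub>R w"
      by (simp add: sum.distrib linear_sum[OF matrix_vector_mul_linear] sum_constant_scaleR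
          del: sum_constant)
    finally have "card (?V M) = 0 \<or> w = 0"
      by (simp add: sum0)
    moreover have "card (?V M) \<noteq> 0"
      by (simp add: columns_hcat_uminus)
    ultimately show ?thesis
      by blast
  qed
  \<comment> \<open>Without translation, each column of \<open>N\<close> is the image under
    \<open>F\<close> of a signed column of \<open>M\<close>; choosing index and sign for every
    \<open>j\<close> yields \<sigma> and \<open>s\<close>.\<close>
  have "\<exists>i s. s \<in> {1, -1} \<and> (\<forall>l. N $ l $ j = s * (F ** M) $ l $ i)" for j
  proof -
    have "column j (real_mat N) \<in> ?V N"
      by (simp add: columns_hcat_uminus)
    then obtain x where x: "x \<in> ?V M" "column j (real_mat N) = real_mat F *v x"
      using VN \<open>w = 0\<close> by auto
    then obtain i s where s: "s \<in> {1, -1::int}" "x = of_int s *\<^sub>R column i (real_mat M)"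
      unfolding columns_hcat_uminus by force
    have "real_of_int (N $ l $ j) = real_of_int (s * (F ** M) $ l $ i)" for l
    proof -
      have "real_of_int (N $ l $ j) = column j (real_mat N) $ l"
        by (simp add: column_def)
      also have "\<dots> = of_int s * (real_mat F *v column i (real_mat M)) $ l"
        by (simp add: x s matrix_vector_mult_scaleR)
      also have "\<dots> = real_of_int (s * (F ** M) $ l $ i)"
        by (simp add: matrix_vector_mult_def matrix_matrix_mult_def column_def)
      finally show ?thesis .
    qed
    then show ?thesis
      using s(1) by (metis of_int_eq_iff)
  qed
  then obtain \<sigma> s where s: "\<And>j. s j \<in> {1, -1}"
      and N: "\<And>l j. N $ l $ j = s j * (F ** M) $ l $ \<sigma> j"
    by metis
  \<comment> \<open>Two columns of \<open>N\<close> from the same column of \<open>F ** M\<close>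
    would agree up to sign, contradicting irredundancy of \<open>N\<close>.\<close>
  have "inj \<sigma>"
  proof (rule injI, rule ccontr)
    fix j k assume "\<sigma> j = \<sigma> k" "j \<noteq> k"
    then have "column j N = column k N \<or> column j N = - column k N"
      using s[of j] s[of k] by (auto simp: vec_eq_iff column_def N)
    then show False
      using \<open>j \<noteq> k\<close> assms(5) by (auto simp: irredundant_columns_def)
  qed
  then have \<sigma>: "bij \<sigma>"
    by (simp add: bij_def finite_UNIV_inj_surj)
  define P :: "int ^ 'n ^ 'n" where "P = (\<chi> i j. if i = \<sigma> j then s j else 0)"
  define Q :: "int ^ 'n ^ 'n" where "Q = (\<chi> i j. if i = \<sigma> j then 1 else 0)"
  have "permutation_matrix Q"
    unfolding permutation_matrix_def Q_def using \<sigma> by (auto intro: bij_imp_permutes)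
  moreover have "P $ i $ j = Q $ i $ j \<or> Q $ i $ j = 1 \<and> P $ i $ j = - 1" for i j
    using s[of j] by (auto simp: P_def Q_def)
  ultimately have "signed_permutation_matrix P"
    unfolding signed_permutation_matrix_def by blast
  moreover have "N = F ** M ** P"
  proof -
    have "(F ** M ** P) $ l $ j = (F ** M) $ l $ \<sigma> j * s j" for l j
      unfolding matrix_matrix_mult_def[of "F ** M"] by (simp add: P_def if_distrib cong: if_cong)
    then show ?thesis
      by (simp add: vec_eq_iff N mult.commute)
  qed
  \<comment> \<open>\<open>N\<close> is a signed column permutation of \<open>F ** M\<close>, whose
    matroid equals that of \<open>M\<close>.\<close>
  moreover have "matroid_isomorphic (matroid_of M) (matroid_of N)"
    using matroid_of_signed_permutation[OF \<sigma> s N] matroid_of_mult[OF injF, of M] by simp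
  ultimately show ?thesis
    using F assms(2-5) by (blast intro: simple_matroid_of regular_matroid_of)
qed

end
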